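(* Let $f_1,\dots,f_N:\mathbb R^n\to\mathbb R\cup\{+\infty\}$ be closed, proper and strictly convex, and suppose that the consensus problem $\min_{x_1,\dots,x_N,z}\sum_{i=1}^N f_i(x_i)$ s.t. $x_i=z$ for all $i$ has a solution $z^*$, with associated optimal dual variables $\lambda^*=(\lambda_1^*,\dots,\lambda_N^* )$. Then there is a class $\mathcal K$ function $\alpha$ such that every iteration $(z,\lambda)\mapsto(z^+,\lambda^+)$ of Reduced Consensus ALADIN satisfies, for every $i$, $$\mathscr L(z,\lambda)-\mathscr L(z^+,\lambda^+)\ \ge\ \alpha\big(\|x_i^+-z^*\|\big)\ \ge\ 0,$$ where $$\mathscr L(z,\lambda)=\frac1\rho\sum_{i=1}^N\|\lambda_i-\lambda_i^*\|^2+\rho N\|z-z^*\|^2 .$$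
   Context: $\|\cdot\|$ is the Euclidean norm and $\rho>0$ is a fixed parameter. One iteration of Reduced Consensus ALADIN maps $(z,\lambda)$, with $z\in\mathbb R^n$, $\lambda=(\lambda_1,\dots,\lambda_N)\in(\mathbb R^n)^N$ and $\sum_{i=1}^N\lambda_i=0$, to $(z^+,\lambda^+)$ by $$x_i^+=\arg\min_{x_i} f_i(x_i)+\lambda_i^\top x_i+\tfrac{\rho}{2}\|x_i-z\|^2,\qquad g_i=\rho(z-x_i^+)-\lambda_i,$$ $$z^+=\frac1N\sum_{i=1}^N\Big(x_i^+-\frac{g_i}{\rho}\Big),\qquad \lambda_i^+=\rho(x_i^+-z^+)-g_i .$$ The update preserves $\sum_i\lambda_i=0$. Optimal dual variables are multipliers $\lambda_i^*$ of the constraints $x_i=z$ satisfying, together with $z^*$, the optimality conditions $-\lambda_i^*\in\partial f_i(z^* )$ for all $i$ and $\sum_{i=1}^N\lambda_i^*=0$. A class $\mathcal K$ function is a continuous, strictly increasing function $\alpha:[0,\infty)\to[0,\infty)$ with $\alpha(0)=0$. *)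

theory Defs
  imports "HOL-Analysis.Analysis"
begin

section \<open>Extended-valued convex functions\<close>

text \<open>
  A function into \<open>\<real> \<union> {+\<infinity>}\<close> is represented by an \<^typ>\<open>ereal\<close>-valued function;
  \<open>proper\<close> excludes the value \<open>-\<infinity>\<close>.
\<close>

definition proper :: "('a \<Rightarrow> ereal) \<Rightarrow> bool" where
  "proper f \<longleftrightarrow> (\<forall>x. f x \<noteq> -\<infinity>) \<and> (\<exists>x. f x \<noteq> \<infinity>)"

text \<open>Closed function: the epigraph, a subset of \<open>'a \<times> \<real>\<close>, is closed.\<close>

definition closed_fun :: "('a::topological_space \<Rightarrow> ereal) \<Rightarrow> bool" where
  "closed_fun f \<longleftrightarrow> closed {(x, r::real). f x \<le> ereal r}"

text \<open>
  The strict inequality can only be required on the effective domain. Convexity of the domain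
  is part of the condition, as the right-hand side is then less than \<open>\<infinity>\<close>.
\<close>

definition strictly_convex :: "('a::real_vector \<Rightarrow> ereal) \<Rightarrow> bool" where
  "strictly_convex f \<longleftrightarrow>
     (\<forall>x y. \<forall>t::real. x \<noteq> y \<and> f x < \<infinity> \<and> f y < \<infinity> \<and> 0 < t \<and> t < 1 \<longrightarrow>
        f (t *\<^sub>R x + (1 - t) *\<^sub>R y) < ereal t * f x + ereal (1 - t) * f y)"

definition subdifferential :: "('a::real_inner \<Rightarrow> ereal) \<Rightarrow> 'a \<Rightarrow> 'a set" where
  "subdifferential f x = {g. \<bar>f x\<bar> \<noteq> \<infinity> \<and> (\<forall>y. f x + ereal (g \<bullet> (y - x)) \<le> f y)}"

section \<open>The consensus problem\<close>

text \<open>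
  The agents are the elements of a finite type \<open>'i\<close>, so \<open>N = CARD('i)\<close>. The value \<open>zs\<close> solves the
  problem if the point \<open>x\<^sub>i = z = zs\<close> is a minimizer with finite objective value.
\<close>

definition consensus_solution :: "('i::finite \<Rightarrow> 'a \<Rightarrow> ereal) \<Rightarrow> 'a \<Rightarrow> bool" where
  "consensus_solution f zs \<longleftrightarrow>
     is_arg_min (\<lambda>(x, z). \<Sum>i\<in>UNIV. f i (x i)) (\<lambda>(x, z). \<forall>i. x i = z) (\<lambda>_. zs, zs) \<and>
     (\<Sum>i\<in>UNIV. f i zs) < \<infinity>"

definition optimal_dual ::
    "('i::finite \<Rightarrow> 'a::real_inner \<Rightarrow> ereal) \<Rightarrow> 'a \<Rightarrow> ('i \<Rightarrow> 'a) \<Rightarrow> bool" where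
  "optimal_dual f zs ls \<longleftrightarrow> (\<forall>i. - ls i \<in> subdifferential (f i) zs) \<and> (\<Sum>i\<in>UNIV. ls i) = 0"

section \<open>Reduced Consensus ALADIN\<close>

text \<open>
  One iteration, with \<open>l\<close> for the dual variables. For closed, proper, convex \<open>f i\<close> and \<open>\<rho> > 0\<close>
  the objective minimized in \<open>aladin_x\<close> has exactly one minimizer, so the choice made by
  \<^const>\<open>arg_min\<close> is unambiguous.
\<close>

definition aladin_x ::
    "('i \<Rightarrow> 'a::real_inner \<Rightarrow> ereal) \<Rightarrow> real \<Rightarrow> 'a \<Rightarrow> ('i \<Rightarrow> 'a) \<Rightarrow> 'i \<Rightarrow> 'a" where
  "aladin_x f \<rho> z l i =
     (ARG_MIN (\<lambda>x. f i x + ereal (l i \<bullet> x + \<rho> / 2 * (norm (x - z))\<^sup>2)) x. True)"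

definition aladin_g ::
    "('i \<Rightarrow> 'a::real_inner \<Rightarrow> ereal) \<Rightarrow> real \<Rightarrow> 'a \<Rightarrow> ('i \<Rightarrow> 'a) \<Rightarrow> 'i \<Rightarrow> 'a" where
  "aladin_g f \<rho> z l i = \<rho> *\<^sub>R (z - aladin_x f \<rho> z l i) - l i"

definition aladin_z ::
    "('i::finite \<Rightarrow> 'a::real_inner \<Rightarrow> ereal) \<Rightarrow> real \<Rightarrow> 'a \<Rightarrow> ('i \<Rightarrow> 'a) \<Rightarrow> 'a" where
  "aladin_z f \<rho> z l =
     (1 / real CARD('i)) *\<^sub>R
       (\<Sum>i\<in>UNIV. aladin_x f \<rho> z l i - (1 / \<rho>) *\<^sub>R aladin_g f \<rho> z l i)"

definition aladin_dual ::
    "('i::finite \<Rightarrow> 'a::real_inner \<Rightarrow> ereal) \<Rightarrow> real \<Rightarrow> 'a \<Rightarrow> ('i \<Rightarrow> 'a) \<Rightarrow> 'i \<Rightarrow> 'a" where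
  "aladin_dual f \<rho> z l i =
     \<rho> *\<^sub>R (aladin_x f \<rho> z l i - aladin_z f \<rho> z l) - aladin_g f \<rho> z l i"

section \<open>Comparison functions and the Lyapunov function\<close>

text \<open>A function on \<open>[0,\<infinity>)\<close> is a function on the reals of which only the restriction matters.\<close>

definition class_K :: "(real \<Rightarrow> real) \<Rightarrow> bool" where
  "class_K \<alpha> \<longleftrightarrow>
     \<alpha> \<in> {0..} \<rightarrow> {0..} \<and> continuous_on {0..} \<alpha> \<and> strict_mono_on {0..} \<alpha> \<and> \<alpha> 0 = 0"

definition lyapunov ::
    "real \<Rightarrow> 'a::real_inner \<Rightarrow> ('i::finite \<Rightarrow> 'a) \<Rightarrow> 'a \<Rightarrow> ('i \<Rightarrow> 'a) \<Rightarrow> real" where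
  "lyapunov \<rho> zs ls z l =
     (1 / \<rho>) * (\<Sum>i\<in>UNIV. (norm (l i - ls i))\<^sup>2) + \<rho> * real CARD('i) * (norm (z - zs))\<^sup>2"

end

theory Submission
  imports Defs
begin

text \<open>
  Put \<open>x\<^sub>i\<close>, \<open>g\<^sub>i\<close> for the primal points and the vectors \<open>g\<close> of one iteration. Since the duals
  and the optimal duals both sum to zero, the decrease of the Lyapunov function is exactly
  \<open>4 * (\<Sum>i. (x\<^sub>i - zs) \<bullet> (g\<^sub>i + ls\<^sub>i))\<close> (\<open>lyapunov_decrease_eq\<close>).

  Each summand is a monotonicity gap of a subdifferential: \<open>- ls\<^sub>i\<close> is a subgradient of \<open>f\<^sub>i\<close> at
  \<open>zs\<close> by optimality of the duals, and \<open>g\<^sub>i\<close> is a subgradient of \<open>f\<^sub>i\<close> at \<open>x\<^sub>i\<close> because \<open>x\<^sub>i\<close>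
  minimizes the proximal objective (\<open>proximal_minimizer_subgradient\<close>; that a minimizer exists is
  \<open>proximal_minimizer_exists\<close>). The subgradient inequality at \<open>x\<^sub>i\<close> bounds the summand from below
  by the Bregman distance \<open>D\<^sub>i x = f\<^sub>i x - f\<^sub>i zs + ls\<^sub>i \<bullet> (x - zs)\<close> at \<open>x = x\<^sub>i\<close>, and the
  subgradient inequality at \<open>zs\<close> makes this distance nonnegative.

  Unlike the monotonicity gap, \<open>D\<^sub>i\<close> is a function of \<open>x\<close> alone, so that the bound is uniform in
  \<open>(z, l)\<close>. By strict convexity \<open>D\<^sub>i\<close> vanishes only at \<open>zs\<close>; compactness of spheres, lower
  semicontinuity and convexity turn this into a positive lower bound outside every ball around \<open>zs\<close>
  (\<open>strictly_convex_bregman_gap\<close>). Such bounds are all that is needed for a class K function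
  \<open>\<alpha>\<close> with \<open>\<alpha> (norm (x - zs)) \<le> D\<^sub>i x\<close> for all \<open>i\<close> and \<open>x\<close> (\<open>class_K_minorant\<close>).
\<close>

section \<open>Class K minorants\<close>

text \<open>
  The natural minorant, the infimum of \<open>d\<close> over all \<open>x\<close> with \<open>s x \<ge> r\<close>, may jump and may be
  constant on intervals. Replacing the constraint \<open>s x \<ge> r\<close> by the penalty \<open>max 0 (r - s x)\<close>
  makes the infimum 1-Lipschitz in \<open>r\<close> and keeps it nondecreasing and positive for \<open>r > 0\<close>; the
  factor \<open>r / (1 + r)\<close> then makes it strictly increasing and zero at zero.
\<close>

lemma class_K_minorant:
  fixes s d :: "'b \<Rightarrow> real"
  assumes ne: "X \<noteq> {}"
    and s0: "\<And>x. x \<in> X \<Longrightarrow> 0 \<le> s x"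
    and d0: "\<And>x. x \<in> X \<Longrightarrow> 0 \<le> d x"
    and pos: "\<And>r. 0 < r \<Longrightarrow> \<exists>\<delta>>0. \<forall>x\<in>X. r \<le> s x \<longrightarrow> \<delta> \<le> d x"
  shows "\<exists>\<alpha>. class_K \<alpha> \<and> (\<forall>x\<in>X. \<alpha> (s x) \<le> d x)"
proof -
  define \<phi> where "\<phi> r = (INF x\<in>X. d x + max 0 (r - s x))" for r
  define \<alpha> where "\<alpha> r = r / (1 + r) * \<phi> r" for r
  have bdd: "bdd_below ((\<lambda>x. d x + max 0 (r - s x)) ` X)" for r
    using d0 by (intro bdd_belowI2[where m = 0]) auto
  have le: "\<phi> r \<le> d x + max 0 (r - s x)" if "x \<in> X" for r x
    unfolding \<phi>_def using bdd that by (rule cINF_lower)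
  have ge: "c \<le> \<phi> r" if "\<And>x. x \<in> X \<Longrightarrow> c \<le> d x + max 0 (r - s x)" for c r
    unfolding \<phi>_def using ne that by (rule cINF_greatest)
  have shift: "\<phi> r \<le> \<phi> r' + \<bar>r - r'\<bar>" for r r'
  proof -
    have "\<phi> r - \<bar>r - r'\<bar> \<le> \<phi> r'"
    proof (rule ge)
      fix x assume "x \<in> X"
      from le[OF this, of r] show "\<phi> r - \<bar>r - r'\<bar> \<le> d x + max 0 (r' - s x)" by linarith
    qed
    then show ?thesis by simp
  qed
  have cont: "continuous_on {0..} \<phi>"
  proof (rule lipschitz_on_continuous_on[of 1], rule lipschitz_onI)
    fix r r' show "dist (\<phi> r) (\<phi> r') \<le> 1 * dist r r'"
      using shift[of r r'] shift[of r' r] by (auto simp: dist_real_def)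
  qed simp
  have mono: "\<phi> r \<le> \<phi> r'" if "r \<le> r'" for r r'
  proof (rule ge)
    fix x assume "x \<in> X"
    from le[OF this, of r] that show "\<phi> r \<le> d x + max 0 (r' - s x)" by linarith
  qed
  have nonneg: "0 \<le> \<phi> r" for r
    by (rule ge) (auto dest: d0)
  have phi_pos: "0 < \<phi> r" if r: "0 < r" for r
  proof -
    obtain \<delta> where \<delta>: "\<delta> > 0" "\<And>x. x \<in> X \<Longrightarrow> r / 2 \<le> s x \<Longrightarrow> \<delta> \<le> d x"
      using pos[OF half_gt_zero[OF r]] by blast
    \<comment> \<open>Points with \<open>s x \<ge> r / 2\<close> have large \<open>d x\<close>, all others pay a penalty above \<open>r / 2\<close>.\<close>
    have "min \<delta> (r / 2) \<le> \<phi> r"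
    proof (rule ge)
      fix x assume x: "x \<in> X"
      show "min \<delta> (r / 2) \<le> d x + max 0 (r - s x)"
      proof (cases "r / 2 \<le> s x")
        case True
        with \<delta>(2)[OF x] show ?thesis by linarith
      next
        case False
        with d0[OF x] show ?thesis by linarith
      qed
    qed
    with \<delta>(1) r show ?thesis by linarith
  qed
  have "class_K \<alpha>"
    unfolding class_K_def
  proof (intro conjI)
    show "\<alpha> \<in> {0..} \<rightarrow> {0..}" by (auto simp: \<alpha>_def nonneg)
    show "continuous_on {0..} \<alpha>"
      unfolding \<alpha>_def by (intro continuous_intros cont) auto
    show "strict_mono_on {0..} \<alpha>"
    proof (rule strict_mono_onI)
      fix r r' :: real assume r: "r \<in> {0..}" "r' \<in> {0..}" "r < r'"
      have "r / (1 + r) * \<phi> r \<le> r / (1 + r) * \<phi> r'"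
        using r by (intro mult_left_mono mono) auto
      also have "\<dots> < r' / (1 + r') * \<phi> r'"
        using r phi_pos[of r'] by (intro mult_strict_right_mono) (auto simp: field_simps)
      finally show "\<alpha> r < \<alpha> r'" by (simp add: \<alpha>_def)
    qed
    show "\<alpha> 0 = 0" by (simp add: \<alpha>_def)
  qed
  moreover have "\<alpha> (s x) \<le> d x" if x: "x \<in> X" for x
  proof -
    have "\<alpha> (s x) \<le> 1 * \<phi> (s x)"
      unfolding \<alpha>_def using s0[OF x] nonneg by (intro mult_right_mono) auto
    also have "\<dots> \<le> d x" using le[OF x, of "s x"] by simp
    finally show ?thesis .
  qed
  ultimately show ?thesis by blast
qed

section \<open>Minimization of closed functions\<close>

text \<open>
  The definition of a closed function is about its epigraph, so the minimum is taken there: on the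
  part of the epigraph over \<open>S\<close> where \<open>r + q x\<close> does not exceed the value at \<open>u\<close>, which is compact
  thanks to the minorant \<open>a\<close>, the continuous function \<open>(x, r) \<mapsto> r + q x\<close> attains its minimum.
\<close>

lemma closed_fun_attains_min_on_compact:
  fixes f :: "'a::euclidean_space \<Rightarrow> ereal" and a q :: "'a \<Rightarrow> real"
  assumes f: "closed_fun f" and S: "compact S"
    and a: "continuous_on UNIV a" and q: "continuous_on UNIV q"
    and lower: "\<And>x. ereal (a x) \<le> f x"
    and u: "u \<in> S" "f u < \<infinity>"
  shows "\<exists>x\<in>S. f x < \<infinity> \<and> (\<forall>y\<in>S. f x + ereal (q x) \<le> f y + ereal (q y))"
proof -
  have fin: "\<exists>r. f y = ereal r" if "f y < \<infinity>" for y
    using that lower[of y] by (cases "f y") auto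
  obtain c where c: "f u = ereal c" using fin u by blast
  define K where "K = {(x, r). f x \<le> ereal r} \<inter> (S \<times> UNIV) \<inter>
    {p. snd p + q (fst p) \<le> c + q u}"
  have uK: "(u, c) \<in> K" using u c by (simp add: K_def)
  have qf: "continuous_on UNIV (\<lambda>p::'a \<times> real. snd p + q (fst p))"
    by (intro continuous_intros continuous_on_compose2[OF q]) auto
  have "closed K"
    unfolding K_def using f[unfolded closed_fun_def] compact_imp_closed[OF S] qf
    by (intro closed_Int closed_Times closed_Collect_le) auto
  moreover have "bounded K"
  proof -
    obtain A where A: "\<And>x. x \<in> S \<Longrightarrow> A \<le> a x"
      using continuous_attains_inf[OF S _ continuous_on_subset[OF a]] u by auto
    obtain B where B: "\<And>x. x \<in> S \<Longrightarrow> B \<le> q x"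
      using continuous_attains_inf[OF S _ continuous_on_subset[OF q]] u by auto
    have "K \<subseteq> S \<times> {A..c + q u - B}"
    proof
      fix p assume "p \<in> K"
      then obtain x r where p: "p = (x, r)" "f x \<le> ereal r" "x \<in> S" "r + q x \<le> c + q u"
        by (cases p) (auto simp: K_def)
      have "ereal (a x) \<le> ereal r" using lower[of x] p(2) by (rule order_trans)
      with A[OF p(3)] B[OF p(3)] p show "p \<in> S \<times> {A..c + q u - B}" by auto
    qed
    moreover have "bounded (S \<times> {A..c + q u - B})"
      using compact_imp_bounded[OF S] by (intro bounded_Times) auto
    ultimately show ?thesis by (rule bounded_subset[rotated])
  qed
  ultimately have "compact K" by (simp add: compact_eq_bounded_closed)
  then obtain p where p: "p \<in> K" "\<And>p'. p' \<in> K \<Longrightarrow> snd p + q (fst p) \<le> snd p' + q (fst p')"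
    using continuous_attains_inf[of K, OF _ _ continuous_on_subset[OF qf]] uK by blast
  obtain x r where xr: "p = (x, r)" by (cases p)
  have x: "x \<in> S" "f x \<le> ereal r" "r + q x \<le> c + q u"
    using p(1) by (auto simp: K_def xr)
  have "f x + ereal (q x) \<le> f y + ereal (q y)" if y: "y \<in> S" for y
  proof (cases "f y < \<infinity>")
    case True
    then obtain b where b: "f y = ereal b" using fin by blast
    have "r + q x \<le> b + q y"
    proof (cases "b + q y \<le> c + q u")
      case True
      then have "(y, b) \<in> K" using y b by (auto simp: K_def)
      from p(2)[OF this] show ?thesis by (simp add: xr)
    qed (use x in simp)
    then have "ereal r + ereal (q x) \<le> f y + ereal (q y)" by (simp add: b)
    with add_right_mono[OF x(2), of "ereal (q x)"] show ?thesis by (rule order_trans)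
  qed simp
  moreover have "f x < \<infinity>" using x(2) by (auto simp: less_top[symmetric])
  ultimately show ?thesis using x(1) by blast
qed

text \<open>
  A subgradient at a single point gives an affine minorant of \<open>f\<close>. Added to the quadratic term it is
  a quadratic whose sublevel sets are balls, and outside the sublevel set \<open>S\<close> through the value at
  \<open>w\<close> the objective is no smaller than at \<open>w\<close>. So a minimizer over the compact set \<open>S\<close> is global.
\<close>

lemma proximal_minimizer_exists:
  fixes f :: "'a::euclidean_space \<Rightarrow> ereal"
  assumes f: "closed_fun f" and \<rho>: "0 < \<rho>" and g: "g \<in> subdifferential f w"
  shows "\<exists>x. f x < \<infinity> \<and>
    is_arg_min (\<lambda>x. f x + ereal (l \<bullet> x + \<rho> / 2 * (norm (x - z))\<^sup>2)) (\<lambda>x. True) x"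
proof -
  obtain c where c: "f w = ereal c"
    using g by (auto simp: subdifferential_def)
  define a where "a x = c + g \<bullet> (x - w)" for x
  define q where "q x = l \<bullet> x + \<rho> / 2 * (norm (x - z))\<^sup>2" for x
  define S where "S = {x. a x + q x \<le> c + q w}"
  have lower: "ereal (a x) \<le> f x" for x
    using g by (auto simp: subdifferential_def c a_def)
  have cont: "continuous_on UNIV a" "continuous_on UNIV q"
    unfolding a_def q_def by (intro continuous_intros)+
  have "closed S"
    unfolding S_def by (intro closed_Collect_le continuous_intros cont)
  moreover have "bounded S"
  proof -
    \<comment> \<open>Completing the square: \<open>v\<close> is the minimizer of the quadratic \<open>a + q\<close>.\<close>
    define v where "v = z - (1 / \<rho>) *\<^sub>R (g + l)"
    define k where "k = a z + q z - \<rho> / 2 * (norm (z - v))\<^sup>2"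
    have square: "a x + q x = \<rho> / 2 * (norm (x - v))\<^sup>2 + k" for x
      using \<rho> unfolding a_def q_def k_def v_def power2_norm_eq_inner
      by (simp add: inner_simps inner_commute field_simps)
    have "S \<subseteq> cball v (sqrt (2 / \<rho> * (c + q w - k)))"
    proof
      fix x assume "x \<in> S"
      then have "\<rho> / 2 * (norm (x - v))\<^sup>2 \<le> c + q w - k"
        using square[of x] by (simp add: S_def)
      then have "(norm (x - v))\<^sup>2 \<le> 2 / \<rho> * (c + q w - k)"
        using \<rho> by (simp add: field_simps)
      then show "x \<in> cball v (sqrt (2 / \<rho> * (c + q w - k)))"
        by (simp add: dist_norm norm_minus_commute real_le_rsqrt)
    qed
    then show ?thesis using bounded_cball bounded_subset by blast
  qed
  ultimately have "compact S" by (simp add: compact_eq_bounded_closed)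
  moreover have wS: "w \<in> S" by (simp add: S_def a_def)
  ultimately obtain x where x: "x \<in> S" "f x < \<infinity>"
    and min: "\<And>y. y \<in> S \<Longrightarrow> f x + ereal (q x) \<le> f y + ereal (q y)"
    using closed_fun_attains_min_on_compact[OF f _ cont lower, of S w] c by auto
  have "f x + ereal (q x) \<le> f y + ereal (q y)" for y
  proof (cases "y \<in> S")
    case False
    have "f x + ereal (q x) \<le> ereal (c + q w)" using min[OF wS] c by simp
    also have "\<dots> \<le> ereal (a y + q y)" using False by (simp add: S_def)
    also have "\<dots> \<le> f y + ereal (q y)" using add_right_mono[OF lower[of y], of "ereal (q y)"] by simp
    finally show ?thesis .
  qed (rule min)
  then show ?thesis
    using x(2) by (auto simp: is_arg_min_def q_def not_less)
qed

section \<open>Strictly convex functions and subgradients\<close>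

lemma strictly_convex_le:
  assumes "strictly_convex f" "f x = ereal a" "f y = ereal b" "0 < t" "t < 1"
  shows "f (t *\<^sub>R x + (1 - t) *\<^sub>R y) \<le> ereal (t * a + (1 - t) * b)"
proof (cases "x = y")
  case True
  have "t *\<^sub>R x + (1 - t) *\<^sub>R x = x" by (simp add: algebra_simps)
  moreover have "t * a + (1 - t) * a = a" by (simp add: algebra_simps)
  ultimately show ?thesis using True assms by simp
next
  case False
  have "f (t *\<^sub>R x + (1 - t) *\<^sub>R y) < ereal t * f x + ereal (1 - t) * f y"
    using assms(1)[unfolded strictly_convex_def, rule_format, of x y t] False assms(2-5) by simp
  then show ?thesis using assms by simp
qed

text \<open>
  This is the first-order condition for the proximal problem, obtained without calculus of
  subdifferentials: compare \<open>x\<close> with \<open>x + t (y - x)\<close>, divide by \<open>t\<close> and let \<open>t\<close> tend to zero, so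
  that the quadratic term contributes its gradient only.
\<close>

lemma proximal_minimizer_subgradient:
  fixes f :: "'a::real_inner \<Rightarrow> ereal"
  assumes pr: "proper f" and conv: "strictly_convex f" and fx: "f x < \<infinity>"
    and min: "is_arg_min (\<lambda>x. f x + ereal (l \<bullet> x + \<rho> / 2 * (norm (x - z))\<^sup>2)) (\<lambda>x. True) x"
  shows "\<rho> *\<^sub>R (z - x) - l \<in> subdifferential f x"
proof -
  define q where "q x = l \<bullet> x + \<rho> / 2 * (norm (x - z))\<^sup>2" for x
  define g where "g = \<rho> *\<^sub>R (z - x) - l"
  have fin: "\<exists>r. f y = ereal r" if "f y < \<infinity>" for y
    using that pr by (cases "f y") (auto simp: proper_def)
  obtain a where a: "f x = ereal a" using fin[OF fx] by blast
  have min': "ereal (a + q x) \<le> f y + ereal (q y)" for y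
    using min by (simp add: is_arg_min_def q_def a not_less flip: plus_ereal.simps(1))
  have "f x + ereal (g \<bullet> (y - x)) \<le> f y" for y
  proof (cases "f y < \<infinity>")
    case True
    then obtain b where b: "f y = ereal b" using fin by blast
    have step: "a + g \<bullet> (y - x) \<le> b + t * (\<rho> / 2 * (norm (y - x))\<^sup>2)" if t: "0 < t" "t < 1" for t
    proof -
      define v where "v = t *\<^sub>R y + (1 - t) *\<^sub>R x"
      have v: "v = x + t *\<^sub>R (y - x)" by (simp add: v_def algebra_simps)
      have qv: "q v = q x - t * (g \<bullet> (y - x)) + t\<^sup>2 * (\<rho> / 2 * (norm (y - x))\<^sup>2)"
        unfolding q_def v g_def power2_norm_eq_inner
        by (simp add: inner_simps inner_commute algebra_simps power2_eq_square)
      have "ereal (a + q x) \<le> ereal (t * b + (1 - t) * a) + ereal (q v)"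
        using min'[of v] add_right_mono[OF strictly_convex_le[OF conv b a t], of "ereal (q v)"]
        unfolding v_def by (rule order_trans)
      then have "t * (a + g \<bullet> (y - x)) \<le> t * (b + t * (\<rho> / 2 * (norm (y - x))\<^sup>2))"
        by (simp add: qv algebra_simps power2_eq_square)
      with t show ?thesis by simp
    qed
    have "a + g \<bullet> (y - x) \<le> b"
    proof (rule tendsto_lowerbound)
      show "((\<lambda>t. b + t * (\<rho> / 2 * (norm (y - x))\<^sup>2)) \<longlongrightarrow> b) (at_right 0)"
        by (auto intro!: tendsto_eq_intros)
      show "\<forall>\<^sub>F t in at_right 0. a + g \<bullet> (y - x) \<le> b + t * (\<rho> / 2 * (norm (y - x))\<^sup>2)"
        by (rule eventually_mono[OF eventually_at_right_real[OF zero_less_one]], rule step) simp_all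
    qed simp
    then show ?thesis by (simp add: a b)
  qed simp
  then show ?thesis by (simp add: subdifferential_def a g_def)
qed

text \<open>
  The Bregman distance \<open>D x = b - c - g \<bullet> (x - w)\<close> is positive off \<open>w\<close>, since its value at the
  midpoint of \<open>x\<close> and \<open>w\<close> is nonnegative and less than half of \<open>D x\<close>. It therefore has a positive
  minimum on the sphere of radius \<open>r\<close>. Beyond the sphere it is no smaller, because convexity makes
  it shrink at least by the factor \<open>t\<close> when \<open>x\<close> is moved to \<open>w + t (x - w)\<close>.
\<close>

lemma strictly_convex_bregman_gap:
  fixes f :: "'a::euclidean_space \<Rightarrow> ereal"
  assumes f: "closed_fun f" "strictly_convex f"
    and g: "g \<in> subdifferential f w" and c: "f w = ereal c"
    and r: "0 < r"
  shows "\<exists>\<delta>>0. \<forall>x b. f x = ereal b \<longrightarrow> r \<le> norm (x - w) \<longrightarrow> \<delta> \<le> b - c - g \<bullet> (x - w)"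
proof -
  have lower: "ereal (c + g \<bullet> (x - w)) \<le> f x" for x
    using g by (auto simp: subdifferential_def c)
  have contract: "\<exists>b'. f (t *\<^sub>R x + (1 - t) *\<^sub>R w) = ereal b' \<and>
      b' - c - t * (g \<bullet> (x - w)) \<le> t * (b - c - g \<bullet> (x - w))"
    if "f x = ereal b" "0 < t" "t \<le> 1" for x b t
  proof (cases "t = 1")
    case False
    let ?y = "t *\<^sub>R x + (1 - t) *\<^sub>R w"
    have "f ?y \<le> ereal (t * b + (1 - t) * c)"
      using strictly_convex_le[OF f(2) that(1) c] that False by simp
    with lower[of ?y] show ?thesis
      by (cases "f ?y") (auto simp: algebra_simps)
  qed (use that in simp)
  have pos: "0 < b - c - g \<bullet> (x - w)" if "f x = ereal b" "x \<noteq> w" for x b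
  proof -
    define y where "y = (1/2) *\<^sub>R x + (1 - 1/2) *\<^sub>R w"
    have yw: "y - w = (1/2) *\<^sub>R (x - w)"
      by (simp only: y_def scaleR_diff_right scaleR_diff_left scaleR_one) simp
    have "f y < ereal (1/2 * b + 1/2 * c)"
      using f(2)[unfolded strictly_convex_def, rule_format, of x w "1/2"] that c
      by (simp add: y_def)
    with lower[of y] have "ereal (c + g \<bullet> (y - w)) < ereal (1/2 * b + 1/2 * c)"
      by (rule order.strict_trans1)
    moreover have "g \<bullet> (y - w) = 1/2 * (g \<bullet> (x - w))" by (simp only: yw inner_scaleR_right)
    ultimately show ?thesis by simp
  qed
  define q where "q x = - (c + g \<bullet> (x - w))" for x
  have sphere: "\<exists>\<delta>>0. \<forall>x b. f x = ereal b \<longrightarrow> norm (x - w) = r \<longrightarrow> \<delta> \<le> b - c - g \<bullet> (x - w)"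
  proof (cases "\<exists>u. norm (u - w) = r \<and> f u < \<infinity>")
    \<comment> \<open>If the sphere misses the effective domain, any positive number will do.\<close>
    case False
    then show ?thesis by (intro exI[of _ 1]) auto
  next
    case True
    then obtain u where u: "u \<in> sphere w r" "f u < \<infinity>"
      by (auto simp: dist_norm norm_minus_commute)
    have "continuous_on UNIV (\<lambda>x. c + g \<bullet> (x - w))" "continuous_on UNIV q"
      unfolding q_def by (intro continuous_intros)+
    from closed_fun_attains_min_on_compact[OF f(1) _ this lower u]
    obtain x where x: "x \<in> sphere w r" "f x < \<infinity>"
      "\<And>y. y \<in> sphere w r \<Longrightarrow> f x + ereal (q x) \<le> f y + ereal (q y)" by auto
    obtain b where b: "f x = ereal b" using x(2) lower[of x] by (cases "f x") auto
    have "x \<noteq> w" using x(1) r by auto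
    from pos[OF b this] show ?thesis
      using x(3) by (intro exI[of _ "b - c - g \<bullet> (x - w)"])
        (force simp: q_def b dist_norm norm_minus_commute)
  qed
  then obtain \<delta> where \<delta>: "\<delta> > 0"
    "\<And>x b. f x = ereal b \<Longrightarrow> norm (x - w) = r \<Longrightarrow> \<delta> \<le> b - c - g \<bullet> (x - w)" by blast
  have "\<delta> \<le> b - c - g \<bullet> (x - w)" if x: "f x = ereal b" "r \<le> norm (x - w)" for x b
  proof -
    define t where "t = r / norm (x - w)"
    have t: "0 < t" "t \<le> 1" "t * norm (x - w) = r"
      using r x(2) order.strict_trans2[OF r x(2)] by (simp_all add: t_def)
    define y where "y = t *\<^sub>R x + (1 - t) *\<^sub>R w"
    have y: "y - w = t *\<^sub>R (x - w)" by (simp add: y_def algebra_simps)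
    obtain b' where b': "f y = ereal b'" "b' - c - t * (g \<bullet> (x - w)) \<le> t * (b - c - g \<bullet> (x - w))"
      using contract[OF x(1) t(1,2)] unfolding y_def by blast
    have "\<delta> \<le> b' - c - g \<bullet> (y - w)"
      using \<delta>(2)[OF b'(1)] t by (simp add: y)
    also have "\<dots> \<le> t * (b - c - g \<bullet> (x - w))" using b'(2) by (simp add: y)
    also have "\<dots> \<le> 1 * (b - c - g \<bullet> (x - w))"
      using lower[of x] x t by (intro mult_right_mono) auto
    finally show ?thesis by simp
  qed
  with \<delta>(1) show ?thesis by blast
qed

section \<open>Decrease of the Lyapunov function\<close>

text \<open>
  Since the \<open>l i\<close> sum to zero, the consensus point after the step is twice the mean of the primal
  points minus \<open>z\<close>, and the duals move by \<open>\<rho> *\<^sub>R d i\<close> with \<open>d i = 2 *\<^sub>R x i - z - zp\<close>; in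
  particular the \<open>d i\<close> sum to zero. Distributing the decrease over the agents, the \<open>i\<close>-th share is
  four times the monotonicity gap plus a remainder \<open>R i\<close> that is linear in \<open>l i - ls i\<close> and
  \<open>d i\<close> with coefficients independent of \<open>i\<close>, so the remainders cancel in the sum.
\<close>

lemma lyapunov_decrease_eq:
  fixes f :: "'i::finite \<Rightarrow> 'a::real_inner \<Rightarrow> ereal"
  assumes \<rho>: "0 < \<rho>" and l: "(\<Sum>i\<in>UNIV. l i) = 0" and ls: "(\<Sum>i\<in>UNIV. ls i) = 0"
  shows "lyapunov \<rho> zs ls z l - lyapunov \<rho> zs ls (aladin_z f \<rho> z l) (aladin_dual f \<rho> z l) =
    4 * (\<Sum>i\<in>UNIV. (aladin_x f \<rho> z l i - zs) \<bullet> (aladin_g f \<rho> z l i + ls i))"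
proof -
  define x where "x = aladin_x f \<rho> z l"
  define zp where "zp = aladin_z f \<rho> z l"
  define N where "N = real CARD('i)"
  have N: "N > 0" by (simp add: N_def)
  have g: "aladin_g f \<rho> z l i = \<rho> *\<^sub>R (z - x i) - l i" for i
    by (simp add: aladin_g_def x_def)
  define d where "d i = 2 *\<^sub>R x i - z - zp" for i
  have dual: "aladin_dual f \<rho> z l i = l i + \<rho> *\<^sub>R d i" for i
    by (simp add: aladin_dual_def g d_def algebra_simps scaleR_2 flip: x_def zp_def)
  have "x i - (1 / \<rho>) *\<^sub>R (\<rho> *\<^sub>R (z - x i) - l i) = 2 *\<^sub>R x i - z + (1 / \<rho>) *\<^sub>R l i" for i
    using \<rho> by (simp add: algebra_simps scaleR_2)
  then have "N *\<^sub>R zp = (\<Sum>i\<in>UNIV. 2 *\<^sub>R x i - z + (1 / \<rho>) *\<^sub>R l i)"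
    using N by (simp add: zp_def aladin_z_def g flip: x_def N_def)
  then have sum_d: "(\<Sum>i\<in>UNIV. d i) = 0"
    by (simp add: d_def sum.distrib sum_subtractf l N_def flip: scaleR_sum_right)
       (simp add: sum_constant_scaleR)
  define R where "R i = 2 * ((l i - ls i) \<bullet> ((z - zs) + (zp - zs))) + 2 * \<rho> * (d i \<bullet> (zp - zs))" for i
  have "(\<Sum>i\<in>UNIV. R i) = 0"
    unfolding R_def sum.distrib sum_distrib_left[symmetric] inner_sum_left[symmetric]
    by (simp add: sum_subtractf l ls sum_d)
  have term_eq: "(1 / \<rho>) * ((norm (l i - ls i))\<^sup>2 - (norm (l i + \<rho> *\<^sub>R d i - ls i))\<^sup>2)
      + \<rho> * ((norm (z - zs))\<^sup>2 - (norm (zp - zs))\<^sup>2)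
    = 4 * ((x i - zs) \<bullet> (\<rho> *\<^sub>R (z - x i) - l i + ls i)) + R i" for i
  proof -
    define u y a b where "u = l i - ls i" "y = x i - zs" "a = z - zs" "b = zp - zs"
    note defs = this
    have e: "l i + \<rho> *\<^sub>R d i - ls i = u + \<rho> *\<^sub>R d i" "d i = 2 *\<^sub>R y - a - b"
      "\<rho> *\<^sub>R (z - x i) - l i + ls i = \<rho> *\<^sub>R (a - y) - u"
      by (simp_all add: defs d_def algebra_simps scaleR_2)
    have "(1 / \<rho>) * ((norm u)\<^sup>2 - (norm (u + \<rho> *\<^sub>R d i))\<^sup>2) = - 2 * (u \<bullet> d i) - \<rho> * (d i \<bullet> d i)"
      using \<rho> unfolding power2_norm_eq_inner
      by (simp add: inner_simps inner_commute field_simps)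
    moreover have "- 2 * (u \<bullet> d i) - \<rho> * (d i \<bullet> d i) + \<rho> * ((norm a)\<^sup>2 - (norm b)\<^sup>2)
      = 4 * (y \<bullet> (\<rho> *\<^sub>R (a - y) - u)) + (2 * (u \<bullet> (a + b)) + 2 * \<rho> * (d i \<bullet> b))"
      unfolding power2_norm_eq_inner e(2)
      by (simp add: inner_simps inner_commute algebra_simps)
    ultimately show ?thesis
      unfolding e(1) e(3) R_def defs(1)[symmetric] defs(3)[symmetric] defs(2)[symmetric] defs(4)[symmetric]
      by linarith
  qed
  have "lyapunov \<rho> zs ls z l - lyapunov \<rho> zs ls zp (aladin_dual f \<rho> z l) =
    (\<Sum>i\<in>UNIV. (1 / \<rho>) * ((norm (l i - ls i))\<^sup>2 - (norm (l i + \<rho> *\<^sub>R d i - ls i))\<^sup>2)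
      + \<rho> * ((norm (z - zs))\<^sup>2 - (norm (zp - zs))\<^sup>2))"
    unfolding lyapunov_def dual sum.distrib sum_distrib_left[symmetric] sum_subtractf
    by (simp add: algebra_simps)
  also have "\<dots> = 4 * (\<Sum>i\<in>UNIV. (x i - zs) \<bullet> (\<rho> *\<^sub>R (z - x i) - l i + ls i))"
    unfolding term_eq sum.distrib sum_distrib_left[symmetric] using \<open>sum R UNIV = 0\<close> by simp
  finally show ?thesis by (simp add: g flip: x_def zp_def)
qed

section \<open>Uniform decrease\<close>

theorem theorem2:
  fixes f :: "'i::finite \<Rightarrow> real ^ 'n \<Rightarrow> ereal"
    and \<rho> :: real
    and zs :: "real ^ 'n"
    and ls :: "'i \<Rightarrow> real ^ 'n"
  assumes "\<rho> > 0"
    and "\<And>i. closed_fun (f i)"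
    and "\<And>i. proper (f i)"
    and "\<And>i. strictly_convex (f i)"
    and "consensus_solution f zs"
    and "optimal_dual f zs ls"
  shows "\<exists>\<alpha>. class_K \<alpha> \<and>
    (\<forall>z l. (\<Sum>i\<in>UNIV. l i) = 0 \<longrightarrow>
      (\<forall>i. lyapunov \<rho> zs ls z l - lyapunov \<rho> zs ls (aladin_z f \<rho> z l) (aladin_dual f \<rho> z l)
              \<ge> \<alpha> (norm (aladin_x f \<rho> z l i - zs))
         \<and> \<alpha> (norm (aladin_x f \<rho> z l i - zs)) \<ge> 0))"
proof -
  have sub: "- ls i \<in> subdifferential (f i) zs" for i
    using assms(6) by (simp add: optimal_dual_def)
  define F where "F i x = real_of_ereal (f i x)" for i x
  have F: "f i x = ereal (F i x)" if "f i x < \<infinity>" for i x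
    using that assms(3)[of i] by (cases "f i x") (auto simp: F_def proper_def)
  have fzs: "f i zs < \<infinity>" for i
    using sub[of i] by (auto simp: subdifferential_def)
  define D where "D i x = F i x - F i zs + ls i \<bullet> (x - zs)" for i x
  have D0: "0 \<le> D i x" if "f i x < \<infinity>" for i x
  proof -
    have "f i zs + ereal (- ls i \<bullet> (x - zs)) \<le> f i x"
      using sub[of i] by (auto simp: subdifferential_def)
    then show ?thesis by (simp add: F[OF that] F[OF fzs] D_def)
  qed
  define X where "X = {(i, x). f i x < \<infinity>}"
  have "\<exists>\<alpha>. class_K \<alpha> \<and> (\<forall>p\<in>X. \<alpha> (norm (snd p - zs)) \<le> D (fst p) (snd p))"
  proof (rule class_K_minorant)
    show "X \<noteq> {}" using fzs by (auto simp: X_def)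
    fix r :: real assume r: "0 < r"
    have "\<forall>i. \<exists>\<delta>>0. \<forall>x. f i x < \<infinity> \<longrightarrow> r \<le> norm (x - zs) \<longrightarrow> \<delta> \<le> D i x"
      using strictly_convex_bregman_gap[OF assms(2,4) sub F[OF fzs] r] F
      unfolding D_def by fastforce
    then obtain \<delta> where \<delta>: "\<And>i. \<delta> i > 0"
      "\<And>i x. f i x < \<infinity> \<Longrightarrow> r \<le> norm (x - zs) \<Longrightarrow> \<delta> i \<le> D i x" by metis
    have "0 < Min (range \<delta>)" using \<delta>(1) by auto
    moreover have "Min (range \<delta>) \<le> D i x" if "f i x < \<infinity>" "r \<le> norm (x - zs)" for i x
      using \<delta>(2)[OF that] by (rule order_trans[rotated]) simp
    ultimately show "\<exists>\<delta>>0. \<forall>p\<in>X. r \<le> norm (snd p - zs) \<longrightarrow> \<delta> \<le> D (fst p) (snd p)"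
      by (intro exI[of _ "Min (range \<delta>)"]) (auto simp: X_def)
  qed (auto simp: X_def D0)
  then obtain \<alpha> where \<alpha>: "class_K \<alpha>"
    "\<And>i x. f i x < \<infinity> \<Longrightarrow> \<alpha> (norm (x - zs)) \<le> D i x"
    by (force simp: X_def)
  show ?thesis
  proof (intro exI[of _ \<alpha>] conjI allI impI \<alpha>(1))
    fix z and l :: "'i \<Rightarrow> real ^ 'n" and i assume l: "(\<Sum>i\<in>UNIV. l i) = 0"
    define x where "x = aladin_x f \<rho> z l"
    define g where "g = aladin_g f \<rho> z l"
    have x: "f j (x j) < \<infinity> \<and> g j \<in> subdifferential (f j) (x j)" for j
    proof -
      let ?h = "\<lambda>y. f j y + ereal (l j \<bullet> y + \<rho> / 2 * (norm (y - z))\<^sup>2)"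
      obtain y where y: "f j y < \<infinity>" "is_arg_min ?h (\<lambda>_. True) y"
        using proximal_minimizer_exists[OF assms(2,1) sub] by blast
      have min: "is_arg_min ?h (\<lambda>_. True) (x j)"
        unfolding x_def aladin_x_def arg_min_def using y(2) by (rule someI)
      then have "?h (x j) \<le> ?h y" by (simp add: is_arg_min_def not_less)
      also have "\<dots> < \<infinity>" using F[OF y(1)] by simp
      finally have fin: "f j (x j) < \<infinity>" by auto
      with proximal_minimizer_subgradient[OF assms(3,4) fin min] show ?thesis
        by (simp add: g_def aladin_g_def x_def)
    qed
    have term_ge: "D j (x j) \<le> (x j - zs) \<bullet> (g j + ls j)" for j
    proof -
      have "f j (x j) + ereal (g j \<bullet> (zs - x j)) \<le> f j zs"
        using x[of j] by (auto simp: subdifferential_def)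
      then show ?thesis
        using F[of j "x j"] F[OF fzs[of j]] x[of j] by (simp add: D_def inner_simps inner_commute)
    qed
    have D0': "0 \<le> D j (x j)" for j using D0 x by blast
    have "\<alpha> (norm (x i - zs)) \<le> D i (x i)" using \<alpha>(2) x by blast
    also have "\<dots> \<le> (\<Sum>j\<in>UNIV. D j (x j))" by (rule member_le_sum) (auto simp: D0')
    also have "\<dots> \<le> 4 * (\<Sum>j\<in>UNIV. D j (x j))" using sum_nonneg[of UNIV "\<lambda>j. D j (x j)"] D0' by simp
    also have "\<dots> \<le> 4 * (\<Sum>j\<in>UNIV. (x j - zs) \<bullet> (g j + ls j))"
      by (intro mult_left_mono sum_mono term_ge) simp
    also have "\<dots> = lyapunov \<rho> zs ls z l - lyapunov \<rho> zs ls (aladin_z f \<rho> z l) (aladin_dual f \<rho> z l)"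
      unfolding x_def g_def using assms(1,6) l
      by (intro lyapunov_decrease_eq[symmetric]) (auto simp: optimal_dual_def)
    finally show "lyapunov \<rho> zs ls z l - lyapunov \<rho> zs ls (aladin_z f \<rho> z l) (aladin_dual f \<rho> z l)
        \<ge> \<alpha> (norm (aladin_x f \<rho> z l i - zs))" by (simp add: x_def)
    show "0 \<le> \<alpha> (norm (aladin_x f \<rho> z l i - zs))"
      using \<alpha>(1) by (auto simp: class_K_def Pi_iff)
  qed
qed

end
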